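(* Let $A\subset\mathbb{R}_+$ be an interval, let $a_1,a_2\in A$ with $0<a_1<a_2$, and let $F_{a_1},F_{a_2}$ be cumulative distribution functions in the class $\mathcal{F}_a$ with densities $f_{a_1},f_{a_2}$. Let $y:(0,1)\to(0,1)$ be the push-forward map from $f_{a_1}$ to $f_{a_2}$. Suppose that $f_{a_1}$ and $f_{a_2}$ are twice differentiable on $(0,1)$, that the limits $\lim_{x\searrow 0}y'(x)$ and $\lim_{x\nearrow 1}y'(x)$ exist in $(1,\infty]$ (each is greater than one or is $+\infty$), and that the second derivative of $f_{a_1}(x)/f_{a_2}(x)$ is strictly positive on $(0,1)$. Then there is a unique $x^*\in(0,1)$ such that for all $x_1,x_2$ with $0<x_1<x^*<x_2<1$ we have $$F_{a_1}(x_1)>F_{a_2}(x_1)\quad\text{and}\quad 1-F_{a_1}(x_2)>1-F_{a_2}(x_2);$$ that is, $F_{a_2}$ is more bunched around $x^*$ than $F_{a_1}$. If instead $a_1>a_2>0$ and the same conditions hold with the roles of the indices $1$ and $2$ interchanged, then $F_{a_2}$ is less bunched around the corresponding point $x^*$ than $F_{a_1}$.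
   Context: Class $\mathcal{F}_a$: for $a$ in some interval $A\subset\mathbb{R}_+$, one says $f_a$ (or its c.d.f. $F_a(x)=\int_0^x f_a(t)\,dt$) is in $\mathcal{F}_a$ if $f_a:[0,1]\to\mathbb{R}$ is a continuous probability density on $[0,1]$ with $f_a(x)>0$ for all $x\in(0,1)$ and $a\in A$. Push-forward map: the push-forward map from $f_{a_1}$ to $f_{a_2}$ is the unique diffeomorphism $y:(0,1)\to(0,1)$ with $f_{a_2}(y(x))\,y'(x)=f_{a_1}(x)$ for all $x\in(0,1)$; equivalently $F_{a_2}(y(x))=F_{a_1}(x)$. Bunching: for c.d.f.'s $F,G$ on $[0,1]$ and $x^*\in(0,1)$, $G$ is more bunched around $x^*$ than $F$ (and $F$ is less bunched around $x^*$ than $G$) if for all $0<x_1<x^*<x_2<1$ we have $F(x_1)>G(x_1)$ and $1-F(x_2)>1-G(x_2)$. *)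

theory Defs
  imports "HOL-Analysis.Analysis"
begin

text \<open>Functions on \<open>[0,1]\<close> or \<open>(0,1)\<close> are total functions of type \<^typ>\<open>real \<Rightarrow> real\<close>, of which
  only the values on the respective interval matter.\<close>

definition density_class :: "real set \<Rightarrow> real \<Rightarrow> (real \<Rightarrow> real) set" where
  "density_class A a = {f. a \<in> A \<and> continuous_on {0..1} f \<and> (\<forall>x\<in>{0..1}. 0 \<le> f x) \<and>
     (f has_integral 1) {0..1} \<and> (\<forall>x\<in>{0<..<1}. 0 < f x)}"

definition cdf01 :: "(real \<Rightarrow> real) \<Rightarrow> real \<Rightarrow> real" where
  "cdf01 f x = integral {0..x} f"

definition diffeomorphism_on :: "real set \<Rightarrow> real set \<Rightarrow> (real \<Rightarrow> real) \<Rightarrow> bool" where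
  "diffeomorphism_on S T y \<longleftrightarrow> bij_betw y S T \<and> y C1_differentiable_on S \<and>
     inv_into S y C1_differentiable_on T"

definition push_forward_map :: "(real \<Rightarrow> real) \<Rightarrow> (real \<Rightarrow> real) \<Rightarrow> (real \<Rightarrow> real) \<Rightarrow> bool" where
  "push_forward_map f g y \<longleftrightarrow> diffeomorphism_on {0<..<1} {0<..<1} y \<and>
     (\<forall>x\<in>{0<..<1}. g (y x) * deriv y x = f x)"

definition more_bunched :: "real \<Rightarrow> (real \<Rightarrow> real) \<Rightarrow> (real \<Rightarrow> real) \<Rightarrow> bool" where
  "more_bunched xs G F \<longleftrightarrow> (\<forall>x1 x2. 0 < x1 \<and> x1 < xs \<and> xs < x2 \<and> x2 < 1 \<longrightarrow>
     F x1 > G x1 \<and> 1 - F x2 > 1 - G x2)"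

definition less_bunched :: "real \<Rightarrow> (real \<Rightarrow> real) \<Rightarrow> (real \<Rightarrow> real) \<Rightarrow> bool" where
  "less_bunched xs F G \<longleftrightarrow> more_bunched xs G F"

text \<open>Differentiability within an open set \<open>S\<close> is two-sided differentiability at each of its
  points; the definition is only meant for open \<open>S\<close>.\<close>

definition twice_differentiable_on :: "(real \<Rightarrow> real) \<Rightarrow> real set \<Rightarrow> bool" where
  "twice_differentiable_on f S \<longleftrightarrow> f differentiable_on S \<and> deriv f differentiable_on S"

text \<open>The limits are taken in \<^typ>\<open>ereal\<close>, so that the value \<open>\<infinity>\<close> is allowed.\<close>

definition bunching_conditions ::
    "(real \<Rightarrow> real) \<Rightarrow> (real \<Rightarrow> real) \<Rightarrow> (real \<Rightarrow> real) \<Rightarrow> bool" where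
  "bunching_conditions f g y \<longleftrightarrow>
     twice_differentiable_on f {0<..<1} \<and> twice_differentiable_on g {0<..<1} \<and>
     (\<exists>L::ereal. 1 < L \<and> ((\<lambda>x. ereal (deriv y x)) \<longlongrightarrow> L) (at_right 0)) \<and>
     (\<exists>L::ereal. 1 < L \<and> ((\<lambda>x. ereal (deriv y x)) \<longlongrightarrow> L) (at_left 1)) \<and>
     (\<forall>x\<in>{0<..<1}. 0 < deriv (deriv (\<lambda>t. f t / g t)) x)"

end

theory Submission imports Defs begin

text \<open>Write \<open>F\<close>, \<open>G\<close> for the distribution functions of the densities \<open>f\<close>, \<open>g\<close> and \<open>y\<close> for the
  push-forward map from \<open>f\<close> to \<open>g\<close>. The whole proof is a sign analysis of \<open>F - G\<close>.

  Since \<open>F = G \<circ> y\<close> (\<open>cdf_push_forward\<close>) and \<open>G\<close> is strictly increasing, \<open>F x\<close> compares with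
  \<open>G x\<close> as \<open>y x\<close> compares with \<open>x\<close>. A slope of \<open>y\<close> greater than one near an end point makes \<open>y\<close>
  move points away from that end point, so \<open>F > G\<close> close to \<open>0\<close> and \<open>F < G\<close> close to \<open>1\<close>. By the
  intermediate value theorem \<open>F = G\<close> at some interior point.

  There is only one such point (\<open>cdf_crossing_unique\<close>): with two of them, \<open>F - G\<close> would have four
  zeros in \<open>[0,1]\<close>, so its derivative \<open>f - g\<close> would have three, that is, \<open>f / g\<close> would take the
  value \<open>1\<close> three times, and Rolle's theorem applied twice more would give a zero of the second
  derivative of \<open>f / g\<close>. Hence \<open>F - G\<close> changes sign exactly once, from positive to negative, and
  the place of this change is the point sought.

  The second half of the theorem is the first half with the two densities interchanged.\<close>

section \<open>Rolle's theorem\<close>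

lemma three_equal_values_imp_second_deriv_zero:
  fixes r :: "real \<Rightarrow> real"
  assumes r: "\<And>x. u \<le> x \<Longrightarrow> x \<le> w \<Longrightarrow> r differentiable (at x)"
    and dr: "\<And>x. u \<le> x \<Longrightarrow> x \<le> w \<Longrightarrow> deriv r differentiable (at x)"
    and "u < v" "v < w" "r u = r v" "r v = r w"
  obtains z where "u < z" "z < w" "deriv (deriv r) z = 0"
proof -
  have rolle: "\<exists>z>a. z < b \<and> deriv h z = 0"
    if h: "\<And>x. a \<le> x \<Longrightarrow> x \<le> b \<Longrightarrow> h differentiable (at x)" and ab: "a < b" "h a = h b"
    for a b and h :: "real \<Rightarrow> real"
  proof -
    have "continuous_on {a..b} h"
      using h by (intro continuous_at_imp_continuous_on)
        (auto intro: differentiable_imp_continuous_within)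
    then obtain z where "a < z" "z < b" "(h has_real_derivative 0) (at z)"
      using Rolle[of a b h] h ab by (metis less_imp_le)
    then show ?thesis by (auto intro: DERIV_imp_deriv)
  qed
  obtain p where p: "u < p" "p < v" "deriv r p = 0"
    using rolle[of u v r] assms by auto
  obtain q where q: "v < q" "q < w" "deriv r q = 0"
    using rolle[of v w r] assms by auto
  obtain z where "p < z" "z < q" "deriv (deriv r) z = 0"
    using rolle[of p q "deriv r"] p q dr by auto
  with p q show thesis by (intro that[of z]) auto
qed

lemma twice_differentiable_on_open_D:
  assumes "twice_differentiable_on f S" "open S" "x \<in> S"
  shows "(f has_real_derivative deriv f x) (at x)" "deriv f differentiable (at x)"
  using assms
  by (auto simp: twice_differentiable_on_def differentiable_on_def at_within_open[OF assms(3,2)]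
      DERIV_deriv_iff_real_differentiable)

lemma twice_differentiable_divide:
  fixes f g :: "real \<Rightarrow> real"
  assumes f: "twice_differentiable_on f S" and g: "twice_differentiable_on g S"
    and S: "open S" "x \<in> S" and nz: "\<And>x. x \<in> S \<Longrightarrow> g x \<noteq> 0"
  shows "(\<lambda>t. f t / g t) differentiable (at x)"
    and "deriv (\<lambda>t. f t / g t) differentiable (at x)"
proof -
  let ?d = "\<lambda>x. (deriv f x * g x - f x * deriv g x) / (g x * g x)"
  note F = twice_differentiable_on_open_D[OF f S(1)] and G = twice_differentiable_on_open_D[OF g S(1)]
  have D: "((\<lambda>t. f t / g t) has_real_derivative ?d x) (at x)" if "x \<in> S" for x
    using DERIV_divide[OF F(1)[OF that] G(1)[OF that] nz[OF that]] .
  show "(\<lambda>t. f t / g t) differentiable (at x)"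
    using D[OF S(2)] real_differentiable_def by blast
  have "f differentiable (at x)" "g differentiable (at x)"
    using F(1) G(1) S(2) real_differentiable_def by blast+
  then have "?d differentiable (at x)"
    using F(2) G(2) S(2) nz
    by (intro differentiable_divide differentiable_diff differentiable_mult) auto
  then obtain c where "(?d has_real_derivative c) (at x)"
    using real_differentiable_def by blast
  then have "(deriv (\<lambda>t. f t / g t) has_real_derivative c) (at x)"
    using S by (rule has_field_derivative_transform_within_open)
      (auto dest: D simp: DERIV_imp_deriv)
  then show "deriv (\<lambda>t. f t / g t) differentiable (at x)"
    using real_differentiable_def by blast
qed

section \<open>Distribution functions of densities on the unit interval\<close>

lemma
  assumes f: "f \<in> density_class A a"
  shows cdf01_0: "cdf01 f 0 = 0"
    and cdf01_1: "cdf01 f 1 = 1"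
    and continuous_on_cdf01: "continuous_on {0..1} (cdf01 f)"
    and density_class_pos: "\<And>x. x \<in> {0<..<1} \<Longrightarrow> 0 < f x"
    and cdf01_deriv: "\<And>x. x \<in> {0<..<1} \<Longrightarrow> (cdf01 f has_real_derivative f x) (at x)"
proof -
  have c: "continuous_on {0..1} f" and i: "(f has_integral 1) {0..1}"
    using f by (auto simp: density_class_def)
  show "cdf01 f 0 = 0" "cdf01 f 1 = 1"
    using i by (auto simp: cdf01_def integral_unique)
  show "continuous_on {0..1} (cdf01 f)"
    unfolding cdf01_def
    by (rule indefinite_integral_continuous_1) (use i in blast)
  show "0 < f x" if "x \<in> {0<..<1}" for x
    using f that by (auto simp: density_class_def)
  show "(cdf01 f has_real_derivative f x) (at x)" if x: "x \<in> {0<..<1}" for x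
  proof -
    have "((\<lambda>u. integral {0..u} f) has_real_derivative f x) (at x within {0..1})"
      by (rule integral_has_real_derivative[OF c]) (use x in auto)
    moreover have "at x within {0..1} = at x"
      by (rule at_within_interior) (use x in auto)
    ultimately show ?thesis
      by (simp add: cdf01_def[abs_def])
  qed
qed

lemma cdf01_strict_mono:
  assumes f: "f \<in> density_class A a" and "0 < u" "u < v" "v < 1"
  shows "cdf01 f u < cdf01 f v"
proof (rule DERIV_pos_imp_increasing[OF \<open>u < v\<close>])
  fix x assume "u \<le> x" "x \<le> v"
  then have "x \<in> {0<..<1}" using assms by auto
  then show "\<exists>d. (cdf01 f has_real_derivative d) (at x) \<and> 0 < d"
    using cdf01_deriv[OF f] density_class_pos[OF f] by blast
qed

text \<open>Two interior crossings, together with the end points \<open>0\<close> and \<open>1\<close>, bound three intervals at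
  whose ends \<open>F - G\<close> vanishes. Each of them contains a point with \<open>f = g\<close>; the sign condition on
  the second derivative of \<open>f / g\<close> allows at most two such points.\<close>

lemma cdf_crossing_unique:
  assumes f: "f \<in> density_class A a" and g: "g \<in> density_class B b"
    and tf: "twice_differentiable_on f {0<..<1}" and tg: "twice_differentiable_on g {0<..<1}"
    and pos: "\<And>x. x \<in> {0<..<1} \<Longrightarrow> 0 < deriv (deriv (\<lambda>t. f t / g t)) x"
    and p: "0 < p" "cdf01 f p = cdf01 g p" and q: "q < 1" "cdf01 f q = cdf01 g q"
  shows "\<not> p < q"
proof
  assume "p < q"
  let ?H = "\<lambda>x. cdf01 f x - cdf01 g x"
  have meet: "\<exists>z>u. z < v \<and> f z / g z = 1"
    if uv: "0 \<le> u" "u < v" "v \<le> 1" "?H u = 0" "?H v = 0" for u v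
  proof -
    have D: "(?H has_real_derivative (f x - g x)) (at x)" if "x \<in> {0<..<1}" for x
      using cdf01_deriv[OF f that] cdf01_deriv[OF g that] by (rule DERIV_diff)
    have "continuous_on {u..v} ?H"
      using that continuous_on_cdf01[OF f] continuous_on_cdf01[OF g]
      by (intro continuous_on_diff) (auto intro: continuous_on_subset)
    moreover have "?H differentiable (at x)" if "u < x" "x < v" for x
      using D[of x] that \<open>0 \<le> u\<close> \<open>v \<le> 1\<close> by (auto simp: real_differentiable_def)
    ultimately obtain z where z: "u < z" "z < v" "(?H has_real_derivative 0) (at z)"
      using Rolle[of u v ?H] uv by metis
    then have z01: "z \<in> {0<..<1}" using uv by auto
    then have "f z - g z = 0" using DERIV_unique[OF D z(3)] by auto
    then show ?thesis using z density_class_pos[OF g z01] by auto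
  qed
  obtain z1 where z1: "0 < z1" "z1 < p" "f z1 / g z1 = 1"
    using meet[of 0 p] p q \<open>p < q\<close> by (auto simp: cdf01_0[OF f] cdf01_0[OF g])
  obtain z2 where z2: "p < z2" "z2 < q" "f z2 / g z2 = 1"
    using meet[of p q] p q \<open>p < q\<close> by auto
  obtain z3 where z3: "q < z3" "z3 < 1" "f z3 / g z3 = 1"
    using meet[of q 1] p q \<open>p < q\<close> by (auto simp: cdf01_1[OF f] cdf01_1[OF g])
  have nz: "\<And>x. x \<in> {0<..<1} \<Longrightarrow> g x \<noteq> 0"
    using density_class_pos[OF g] by force
  note diffble = twice_differentiable_divide[OF tf tg open_greaterThanLessThan _ nz]
  obtain z where "z1 < z" "z < z3" "deriv (deriv (\<lambda>t. f t / g t)) z = 0"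
  proof (rule three_equal_values_imp_second_deriv_zero[of z1 z3 "\<lambda>t. f t / g t" z2])
    show "(\<lambda>t. f t / g t) differentiable (at x)" "deriv (\<lambda>t. f t / g t) differentiable (at x)"
      if "z1 \<le> x" "x \<le> z3" for x
      using diffble[of x] that z1 z3 by auto
  qed (use z1 z2 z3 in auto)
  then show False using pos[of z] z1 z3 by auto
qed

section \<open>The push-forward map\<close>

lemma push_forward_mapD:
  assumes y: "push_forward_map f g y" and f: "f \<in> density_class A a" and g: "g \<in> density_class B b"
    and x: "x \<in> {0<..<1}"
  shows "y x \<in> {0<..<1}" "(y has_real_derivative deriv y x) (at x)" "0 < deriv y x"
    "g (y x) * deriv y x = f x"
proof -
  have bij: "bij_betw y {0<..<1} {0<..<1}" and C1: "y C1_differentiable_on {0<..<1}"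
    using y by (auto simp: push_forward_map_def diffeomorphism_on_def)
  show yx: "y x \<in> {0<..<1}" using bij x by (auto simp: bij_betw_def)
  show "(y has_real_derivative deriv y x) (at x)"
    using C1 x by (auto simp: C1_differentiable_on_eq DERIV_deriv_iff_real_differentiable)
  show eq: "g (y x) * deriv y x = f x"
    using y x by (auto simp: push_forward_map_def)
  show "0 < deriv y x"
    using eq density_class_pos[OF f x] density_class_pos[OF g yx]
    by (metis zero_less_mult_pos)
qed

lemma push_forward_map_tendsto_0:
  assumes y: "push_forward_map f g y" and f: "f \<in> density_class A a" and g: "g \<in> density_class B b"
  shows "(y \<longlongrightarrow> 0) (at_right 0)"
proof (rule order_tendstoI)
  note D = push_forward_mapD[OF y f g]
  have near: "eventually (\<lambda>x. x \<in> {0<..<c}) (at_right 0)" if "0 < c" for c :: real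
    using that by (rule eventually_at_right_real)
  show "\<forall>\<^sub>F x in at_right 0. e < y x" if "e < 0" for e
  proof (rule eventually_mono[OF near[of 1]])
    show "e < y x" if "x \<in> {0<..<1}" for x
      using D(1)[OF that] \<open>e < 0\<close> by auto
  qed auto
  show "\<forall>\<^sub>F x in at_right 0. y x < e" if "0 < e" for e
  proof -
    \<comment> \<open>The value \<open>min e (1/2)\<close> is attained, and to the left of the point where it is attained the
      increasing map \<open>y\<close> stays below it.\<close>
    have "min e (1/2) \<in> y ` {0<..<1}"
      using y that by (auto simp: push_forward_map_def diffeomorphism_on_def bij_betw_def)
    then obtain c where c: "c \<in> {0<..<1}" "y c = min e (1/2)" by auto
    have "y x < e" if "x \<in> {0<..<c}" for x
    proof -
      have "y x < y c"
      proof (rule DERIV_pos_imp_increasing[of x c y])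
        fix t assume "x \<le> t" "t \<le> c"
        then have "t \<in> {0<..<1}" using that c by auto
        then show "\<exists>s. (y has_real_derivative s) (at t) \<and> 0 < s" using D(2,3) by blast
      qed (use that in auto)
      then show ?thesis using c by auto
    qed
    with near[of c] c(1) show ?thesis by (auto elim: eventually_mono)
  qed
qed

text \<open>By the change of variables formula the two sides have the same derivative; they agree
  because both tend to \<open>0\<close> at the left end point.\<close>

lemma cdf_push_forward:
  assumes y: "push_forward_map f g y" and f: "f \<in> density_class A a" and g: "g \<in> density_class B b"
    and x: "x \<in> {0<..<1}"
  shows "cdf01 f x = cdf01 g (y x)"
proof -
  note D = push_forward_mapD[OF y f g]
  let ?K = "\<lambda>x. cdf01 f x - cdf01 g (y x)"
  have "(?K has_real_derivative 0) (at x)" if x: "x \<in> {0<..<1}" for x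
  proof -
    have "((\<lambda>x. cdf01 g (y x)) has_real_derivative g (y x) * deriv y x) (at x)"
      by (rule DERIV_chain2[OF cdf01_deriv[OF g D(1)[OF x]] D(2)[OF x]])
    from DERIV_diff[OF cdf01_deriv[OF f x] this] show ?thesis
      using D(4)[OF x] by simp
  qed
  then obtain c where c: "\<And>x. x \<in> {0<..<1} \<Longrightarrow> ?K x = c"
    using has_field_derivative_zero_constant[of "{0<..<1}" ?K]
    by (metis convex_real_interval(8) has_field_derivative_at_within)
  have near: "eventually (\<lambda>x. x \<in> {0<..<1::real}) (at_right 0)"
    using eventually_at_right_real by force
  have lim: "(cdf01 h \<longlongrightarrow> 0) (at 0 within {0..1})" if "h \<in> density_class C k" for h C k
    using continuous_on_cdf01[OF that, unfolded continuous_on_def, rule_format, of 0]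
    by (simp add: cdf01_0[OF that])
  have "(?K \<longlongrightarrow> 0 - 0) (at_right 0)"
  proof (rule tendsto_diff)
    have "filterlim (\<lambda>x. x) (at 0 within {0..1::real}) (at_right 0)"
      unfolding filterlim_at using near by (auto elim: eventually_mono)
    from filterlim_compose[OF lim[OF f] this] show "(cdf01 f \<longlongrightarrow> 0) (at_right 0)" .
    have "filterlim y (at 0 within {0..1}) (at_right 0)"
      unfolding filterlim_at using push_forward_map_tendsto_0[OF y f g] near D(1)
      by (force elim: eventually_mono)
    from filterlim_compose[OF lim[OF g] this]
    show "((\<lambda>x. cdf01 g (y x)) \<longlongrightarrow> 0) (at_right 0)" .
  qed
  moreover have "(?K \<longlongrightarrow> c) (at_right 0)"
    using near c by (intro tendsto_eventually) (auto elim: eventually_mono)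
  ultimately have "c = 0"
    using tendsto_unique[OF trivial_limit_at_right_real] by fastforce
  with c[OF x] show ?thesis by simp
qed

text \<open>For \<open>u < x\<close> close to \<open>0\<close> the mean value theorem gives \<open>y x - y u > x - u\<close>. Using only
  \<open>y u > 0\<close> and letting \<open>u\<close> tend to \<open>0\<close> yields \<open>y x \<ge> x\<close>; the inequality becomes strict by
  comparing with \<open>u = x / 2\<close>. The other end point is symmetric.\<close>

lemma steep_near_0_imp_above_id:
  fixes y :: "real \<Rightarrow> real"
  assumes D: "\<And>x. x \<in> {0<..<d} \<Longrightarrow> (y has_real_derivative deriv y x) (at x) \<and> 1 < deriv y x"
    and pos: "\<And>x. x \<in> {0<..<d} \<Longrightarrow> 0 < y x" and x: "x \<in> {0<..<d}"
  shows "x < y x"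
proof -
  have mono: "y u - u < y v - v" if "0 < u" "u < v" "v < d" for u v
  proof (rule DERIV_pos_imp_increasing[OF \<open>u < v\<close>])
    fix t assume "u \<le> t" "t \<le> v"
    then have "(y has_real_derivative deriv y t) (at t)" "1 < deriv y t"
      using D[of t] that by auto
    then show "\<exists>c. ((\<lambda>x. y x - x) has_real_derivative c) (at t) \<and> 0 < c"
      by (intro exI[of _ "deriv y t - 1"]) (auto intro!: derivative_eq_intros)
  qed
  have "v \<le> y v" if "0 < v" "v < d" for v
  proof (rule field_le_epsilon)
    fix e :: real assume "0 < e"
    define u where "u = min e (v / 2)"
    have u: "0 < u" "u < v" "u \<le> e" using \<open>0 < e\<close> that by (auto simp: u_def)
    then show "v \<le> y v + e" using mono[of u v] pos[of u] that by auto
  qed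
  from this[of "x / 2"] mono[of "x / 2" x] x show ?thesis by auto
qed

lemma steep_near_1_imp_below_id:
  fixes y :: "real \<Rightarrow> real"
  assumes D: "\<And>x. x \<in> {d<..<1} \<Longrightarrow> (y has_real_derivative deriv y x) (at x) \<and> 1 < deriv y x"
    and less1: "\<And>x. x \<in> {d<..<1} \<Longrightarrow> y x < 1" and x: "x \<in> {d<..<1}"
  shows "y x < x"
proof -
  \<comment> \<open>Reflecting both axes at \<open>1/2\<close> preserves slopes and exchanges the two end points.\<close>
  let ?z = "\<lambda>t. 1 - y (1 - t)"
  have Dz: "(?z has_real_derivative deriv y (1 - t)) (at t)" if "t \<in> {0<..<1 - d}" for t
  proof -
    have "(y has_real_derivative deriv y (1 - t)) (at (1 - t))" using D[of "1 - t"] that by auto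
    then have "((\<lambda>t. y (1 - t)) has_real_derivative deriv y (1 - t) * -1) (at t)"
      by (rule DERIV_chain2) (auto intro!: derivative_eq_intros)
    from DERIV_diff[OF DERIV_const[of 1] this] show ?thesis by simp
  qed
  have "1 - x < ?z (1 - x)"
  proof (rule steep_near_0_imp_above_id[of "1 - d"])
    show "(?z has_real_derivative deriv ?z t) (at t) \<and> 1 < deriv ?z t"
      if "t \<in> {0<..<1 - d}" for t
      using Dz[OF that] DERIV_imp_deriv[OF Dz[OF that]] D[of "1 - t"] that by auto
    show "0 < ?z t" if "t \<in> {0<..<1 - d}" for t
      using less1[of "1 - t"] that by auto
  qed (use x in auto)
  then show ?thesis by simp
qed

section \<open>Bunching\<close>

text \<open>A limit of \<open>y'\<close> in \<open>(1, \<infinity>]\<close> keeps \<open>y'\<close> above one near the end point, so \<open>y\<close> lies on a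
  known side of the identity there, and \<open>F = G \<circ> y\<close> turns this into an order of \<open>F\<close> and \<open>G\<close>.\<close>

lemma cdf_order_near_ends:
  assumes y: "push_forward_map f g y" and f: "f \<in> density_class A a" and g: "g \<in> density_class B b"
    and bc: "bunching_conditions f g y"
  shows "\<exists>d. 0 < d \<and> d < 1 \<and> (\<forall>x\<in>{0<..<d}. cdf01 g x < cdf01 f x)" (is ?left)
    and "\<exists>d. 0 < d \<and> d < 1 \<and> (\<forall>x\<in>{d<..<1}. cdf01 f x < cdf01 g x)" (is ?right)
proof -
  note D = push_forward_mapD[OF y f g]
  obtain L R :: ereal where
    L: "1 < L" "((\<lambda>x. ereal (deriv y x)) \<longlongrightarrow> L) (at_right 0)" and
    R: "1 < R" "((\<lambda>x. ereal (deriv y x)) \<longlongrightarrow> R) (at_left 1)"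
    using bc unfolding bunching_conditions_def by blast
  have "\<forall>\<^sub>F x in at_right 0. 1 < deriv y x" "\<forall>\<^sub>F x in at_left 1. 1 < deriv y x"
    using order_tendstoD(1)[OF L(2,1)] order_tendstoD(1)[OF R(2,1)] by simp_all
  then obtain l r where
    l: "0 < l" "\<And>x. 0 < x \<Longrightarrow> x < l \<Longrightarrow> 1 < deriv y x" and
    r: "r < 1" "\<And>x. r < x \<Longrightarrow> x < 1 \<Longrightarrow> 1 < deriv y x"
    unfolding eventually_at_right_field eventually_at_left_field by blast
  show ?left
  proof (intro exI[of _ "min l (1/2)"] conjI ballI)
    fix x assume x: "x \<in> {0<..<min l (1/2)}"
    have "x < y x"
      by (rule steep_near_0_imp_above_id[of "min l (1/2)"]) (use x l D in auto)
    then have "cdf01 g x < cdf01 g (y x)"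
      using x D(1)[of x] by (intro cdf01_strict_mono[OF g]) auto
    then show "cdf01 g x < cdf01 f x"
      using cdf_push_forward[OF y f g, of x] x by auto
  qed (use l in auto)
  show ?right
  proof (intro exI[of _ "max r (1/2)"] conjI ballI)
    fix x assume x: "x \<in> {max r (1/2)<..<1}"
    have "y x < x"
      by (rule steep_near_1_imp_below_id[of "max r (1/2)"]) (use x r D in auto)
    then have "cdf01 g (y x) < cdf01 g x"
      using x D(1)[of x] by (intro cdf01_strict_mono[OF g]) auto
    then show "cdf01 f x < cdf01 g x"
      using cdf_push_forward[OF y f g, of x] x by auto
  qed (use r in auto)
qed

lemma more_bunched_point_unique:
  assumes "p \<in> {0<..<1}" "more_bunched p G F" "q \<in> {0<..<1}" "more_bunched q G F"
  shows "p = q"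
proof -
  \<comment> \<open>Halfway between two different points, both strict orders of \<open>F\<close> and \<open>G\<close> would hold.\<close>
  have False if p: "0 < p" "more_bunched p G F" and q: "q < 1" "more_bunched q G F" and "p < q"
    for p q
  proof -
    have "F ((p + q) / 2) > G ((p + q) / 2)"
      using q(2)[unfolded more_bunched_def, rule_format, of "(p + q) / 2" "(q + 1) / 2"] p q \<open>p < q\<close>
      by auto
    moreover have "1 - F ((p + q) / 2) > 1 - G ((p + q) / 2)"
      using p(2)[unfolded more_bunched_def, rule_format, of "p / 2" "(p + q) / 2"] p q \<open>p < q\<close>
      by auto
    ultimately show False by simp
  qed
  from this[of p q] this[of q p] assms show ?thesis by (cases p q rule: linorder_cases) auto
qed

lemma bunching_conditions_imp_more_bunched:
  assumes f: "f \<in> density_class A a" and g: "g \<in> density_class B b"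
    and y: "push_forward_map f g y" and bc: "bunching_conditions f g y"
  shows "\<exists>!xs. xs \<in> {0<..<1} \<and> more_bunched xs (cdf01 g) (cdf01 f)"
proof -
  let ?H = "\<lambda>x. cdf01 f x - cdf01 g x"
  obtain l where l: "0 < l" "l < 1" "\<And>x. x \<in> {0<..<l} \<Longrightarrow> 0 < ?H x"
    using cdf_order_near_ends(1)[OF y f g bc] by auto
  obtain r where r: "0 < r" "r < 1" "\<And>x. x \<in> {r<..<1} \<Longrightarrow> ?H x < 0"
    using cdf_order_near_ends(2)[OF y f g bc] by auto
  have zero_between: "\<exists>z\<ge>u. z \<le> v \<and> ?H z = 0"
    if "0 < u" "u \<le> v" "v < 1" "?H v \<le> 0" "0 \<le> ?H u" for u v
  proof -
    have "continuous_on {u..v} ?H"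
      using that continuous_on_cdf01[OF f] continuous_on_cdf01[OF g]
      by (intro continuous_on_diff) (auto intro: continuous_on_subset)
    with IVT2'[of ?H v 0 u] that show ?thesis by auto
  qed
  define u v where "u = min l r / 2" and "v = (max l r + 1) / 2"
  have uv: "0 < u" "u < v" "v < 1" "0 < ?H u" "?H v < 0"
    using l(1,2) r(1,2) l(3)[of u] r(3)[of v] by (auto simp: u_def v_def min_def max_def)
  obtain c where c: "u \<le> c" "c \<le> v" "?H c = 0"
    using zero_between[of u v] uv by auto
  have c01: "c \<in> {0<..<1}" using c uv by auto
  have only: "z = c" if "0 < z" "z < 1" "?H z = 0" for z
  proof -
    have cross: "\<not> p < q"
      if "0 < p" "cdf01 f p = cdf01 g p" "q < 1" "cdf01 f q = cdf01 g q" for p q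
      using bc that unfolding bunching_conditions_def
      by (intro cdf_crossing_unique[OF f g]) auto
    from cross[of z c] cross[of c z] that c c01 show ?thesis by auto
  qed
  \<comment> \<open>A wrong sign at a point before or after \<open>c\<close> would force a zero of \<open>?H\<close> between that point and
    a point even closer to the end of the interval, where the sign is known.\<close>
  have left: "0 < ?H x" if x: "0 < x" "x < c" for x
  proof (rule ccontr)
    assume neg: "\<not> 0 < ?H x"
    define w where "w = min x l / 2"
    have w: "0 < w" "w < x" "0 < ?H w"
      using that l(1) l(3)[of w] by (auto simp: w_def min_def)
    obtain z where "w \<le> z" "z \<le> x" "?H z = 0"
      using zero_between[of w x] w neg x c01 by auto
    with only[of z] w x c01 show False by auto
  qed
  have right: "?H x < 0" if x: "c < x" "x < 1" for x
  proof (rule ccontr)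
    assume neg: "\<not> ?H x < 0"
    define w where "w = (max x r + 1) / 2"
    have w: "x < w" "w < 1" "?H w < 0"
      using that r(2) r(3)[of w] by (auto simp: w_def max_def)
    obtain z where "x \<le> z" "z \<le> w" "?H z = 0"
      using zero_between[of x w] w neg x c01 by auto
    with only[of z] w x c01 show False by auto
  qed
  have "more_bunched c (cdf01 g) (cdf01 f)"
    unfolding more_bunched_def using left right by force
  with c01 show ?thesis
    using more_bunched_point_unique by blast
qed

theorem theorem3p4:
  fixes A :: "real set" and f :: "real \<Rightarrow> real \<Rightarrow> real" and a1 a2 :: real
    and y :: "real \<Rightarrow> real"
  assumes "is_interval A" and "A \<subseteq> {0..}"
    and "a1 \<in> A" and "a2 \<in> A"
    and "f a1 \<in> density_class A a1" and "f a2 \<in> density_class A a2"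
  shows "(0 < a1 \<and> a1 < a2 \<and> push_forward_map (f a1) (f a2) y \<and>
            bunching_conditions (f a1) (f a2) y \<longrightarrow>
          (\<exists>!xs. xs \<in> {0<..<1} \<and> more_bunched xs (cdf01 (f a2)) (cdf01 (f a1)))) \<and>
         (0 < a2 \<and> a2 < a1 \<and> push_forward_map (f a2) (f a1) y \<and>
            bunching_conditions (f a2) (f a1) y \<longrightarrow>
          (\<exists>!xs. xs \<in> {0<..<1} \<and> less_bunched xs (cdf01 (f a2)) (cdf01 (f a1))))"
  using bunching_conditions_imp_more_bunched[OF assms(5,6), of y]
    bunching_conditions_imp_more_bunched[OF assms(6,5), of y]
  unfolding less_bunched_def by blast

end
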